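(* Let $N\ge2$. A function $\nu:\mathbb{R}^N\to\mathbb{R}$ is an order-based fairness measure with weight vector $\mathbf{w}\in\mathcal{W}$ (i.e. there exists $\mathbf{w}\in\mathcal{W}$ such that $\nu(\mathbf{u})=\sum_{i=1}^N w_i u_{(i)}$ for all $\mathbf{u}\in\mathbb{R}^N$) if and only if $\nu$ satisfies the axioms Normalization, Schur Convexity, Positive Homogeneity, and Proportional Adjustment.
   Context: For $\mathbf{u}\in\mathbb{R}^N$, $u_{(i)}$ denotes the $i$th smallest entry of $\mathbf{u}$; $\mathbf{1}$ is the all-ones vector, $\mathbf{e}_j$ is the $j$th standard unit vector, and $\mathbb{R}_{\uparrow}^N=\{\mathbf{x}\in\mathbb{R}^N\mid x_1\le\dots\le x_N\}$. Define $\mathcal{W}=\{\mathbf{w}\in\mathbb{R}^N\mid \sum_{i=1}^N w_i=0,\ w_1\le\dots\le w_N,\ w_1<0,\ w_N>0\}$. For $\mathbf{x},\mathbf{y}\in\mathbb{R}^N$, $\mathbf{x}\preceq\mathbf{y}$ means $\sum_{i=1}^N x_i=\sum_{i=1}^N y_i$ and $\sum_{i=k}^N x_{(i)}\le\sum_{i=k}^N y_{(i)}$ for all $k\in\{2,\dots,N\}$. Axioms for a function $\phi:\mathbb{R}^N\to\mathbb{R}$: - Normalization: $\phi(\mathbf{u})\ge0$ for all $\mathbf{u}\in\mathbb{R}^N$, and $\phi(\mathbf{u})=0$ if and only if $\mathbf{u}=\alpha\mathbf{1}$ for some $\alpha\in\mathbb{R}$. - Schur Convexity: if $\mathbf{u}^1\preceq\mathbf{u}^2$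 then $\phi(\mathbf{u}^1)\le\phi(\mathbf{u}^2)$. - Positive Homogeneity: $\phi(\alpha\mathbf{u})=\alpha\phi(\mathbf{u})$ for all $\mathbf{u}\in\mathbb{R}^N$, $\alpha>0$. - Proportional Adjustment: there exist constants $w_1,\dots,w_N\in\mathbb{R}$ such that $\phi(\mathbf{u}+\varepsilon\mathbf{e}_j)=\phi(\mathbf{u})+\varepsilon w_j$ for all $\mathbf{u}\in\mathbb{R}_{\uparrow}^N$, all $j\in\{1,\dots,N\}$, and all $\varepsilon\in[0,u_{j+1}-u_j]$, where for $j=N$ the interval $[0,u_{N+1}-u_N]$ is read as $[0,\infty)$. *)

theory Defs
  imports Complex_Main "Jordan_Normal_Form.Matrix"
begin

text \<open>
  Vectors in N-dimensional real space are elements of \<open>carrier_vec N\<close>. Their entries are indexed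
  from 0, so the mathematical index \<open>i\<close> in \<open>{1..N}\<close> is \<open>i - 1\<close> here. A function on this space is
  an arbitrary function on \<open>real vec\<close>, and all conditions on it are restricted to \<open>carrier_vec N\<close>.
\<close>

definition order_stat :: "real vec \<Rightarrow> nat \<Rightarrow> real" where
  "order_stat u i = sort (list_of_vec u) ! i"

definition ones_vec :: "nat \<Rightarrow> real vec" where
  "ones_vec N = vec N (\<lambda>_. 1)"

definition incr_vecs :: "nat \<Rightarrow> real vec set" where
  "incr_vecs N = {x \<in> carrier_vec N. \<forall>i. Suc i < N \<longrightarrow> x $ i \<le> x $ Suc i}"

definition weights :: "nat \<Rightarrow> real vec set" where
  "weights N = {w \<in> incr_vecs N. (\<Sum>i<N. w $ i) = 0 \<and> w $ 0 < 0 \<and> w $ (N - 1) > 0}"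

definition majorized :: "nat \<Rightarrow> real vec \<Rightarrow> real vec \<Rightarrow> bool" where
  "majorized N x y \<longleftrightarrow>
     (\<Sum>i<N. x $ i) = (\<Sum>i<N. y $ i) \<and>
     (\<forall>k\<in>{1..<N}. (\<Sum>i=k..<N. order_stat x i) \<le> (\<Sum>i=k..<N. order_stat y i))"

definition order_based_measure :: "nat \<Rightarrow> real vec \<Rightarrow> (real vec \<Rightarrow> real) \<Rightarrow> bool" where
  "order_based_measure N w \<nu> \<longleftrightarrow>
     (\<forall>u\<in>carrier_vec N. \<nu> u = (\<Sum>i<N. w $ i * order_stat u i))"

definition normalization :: "nat \<Rightarrow> (real vec \<Rightarrow> real) \<Rightarrow> bool" where
  "normalization N \<phi> \<longleftrightarrow>
     (\<forall>u\<in>carrier_vec N. \<phi> u \<ge> 0 \<and> (\<phi> u = 0 \<longleftrightarrow> (\<exists>\<alpha>. u = \<alpha> \<cdot>\<^sub>v ones_vec N)))"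

definition schur_convexity :: "nat \<Rightarrow> (real vec \<Rightarrow> real) \<Rightarrow> bool" where
  "schur_convexity N \<phi> \<longleftrightarrow>
     (\<forall>u\<in>carrier_vec N. \<forall>v\<in>carrier_vec N. majorized N u v \<longrightarrow> \<phi> u \<le> \<phi> v)"

definition positive_homogeneity :: "nat \<Rightarrow> (real vec \<Rightarrow> real) \<Rightarrow> bool" where
  "positive_homogeneity N \<phi> \<longleftrightarrow>
     (\<forall>u\<in>carrier_vec N. \<forall>\<alpha>>0. \<phi> (\<alpha> \<cdot>\<^sub>v u) = \<alpha> * \<phi> u)"

text \<open>
  The step size for the last coordinate is unbounded above, hence the guard \<open>Suc j < N\<close>.
\<close>

definition proportional_adjustment :: "nat \<Rightarrow> (real vec \<Rightarrow> real) \<Rightarrow> bool" where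
  "proportional_adjustment N \<phi> \<longleftrightarrow>
     (\<exists>w\<in>carrier_vec N. \<forall>u\<in>incr_vecs N. \<forall>j<N. \<forall>\<epsilon>\<ge>0.
        (Suc j < N \<longrightarrow> \<epsilon> \<le> u $ Suc j - u $ j) \<longrightarrow>
        \<phi> (u + \<epsilon> \<cdot>\<^sub>v unit_vec N j) = \<phi> u + \<epsilon> * w $ j)"

end

theory Submission
  imports Defs
begin

text \<open>
  Both directions rest on summation by parts: \<open>\<Sum> w\<^sub>i u\<^sub>i\<close> is \<open>u\<^sub>0 \<Sum> w\<^sub>i\<close> plus the nonnegative
  gaps of \<open>u\<close> weighted by the tail sums of \<open>w\<close>, which are positive for \<open>w \<in> weights N\<close>; exchanging
  the roles of \<open>w\<close> and \<open>u\<close>, monotonicity of \<open>w\<close> gives Schur convexity. Conversely, proportional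
  adjustment allows one to climb from a constant vector, on which \<open>\<nu>\<close> vanishes, to any increasing
  vector, raising the coordinates from the last to the first. This determines \<open>\<nu>\<close> on increasing
  vectors. A vector and its increasing rearrangement majorize each other, so Schur convexity
  determines \<open>\<nu>\<close> everywhere. Test vectors then show that the weights lie in \<open>weights N\<close>.
\<close>

section \<open>Order statistics and increasing vectors\<close>

lemma incr_vecs_mono:
  assumes "u \<in> incr_vecs N" "i \<le> j" "j < N"
  shows "u $ i \<le> u $ j"
  using assms(2,3)
proof (induction j rule: dec_induct)
  case (step n)
  then have "u $ n \<le> u $ Suc n"
    using assms(1) by (auto simp: incr_vecs_def)
  with step show ?case by simp
qed simp

lemma order_stat_incr_vecs:
  assumes "u \<in> incr_vecs N" "i < N"
  shows "order_stat u i = u $ i"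
proof -
  have "dim_vec u = N"
    using assms(1) by (auto simp: incr_vecs_def)
  moreover from this have "sorted (list_of_vec u)"
    using assms(1) by (auto simp: sorted_iff_nth_Suc list_of_vec_index incr_vecs_def)
  ultimately show ?thesis
    using assms(2) by (simp add: order_stat_def sorted_sort_id list_of_vec_index)
qed

lemma order_stat_mono:
  assumes "i \<le> j" "j < dim_vec u"
  shows "order_stat u i \<le> order_stat u j"
  using assms by (auto simp: order_stat_def intro: sorted_nth_mono)

lemma sum_order_stat:
  "(\<Sum>i<dim_vec u. order_stat u i) = (\<Sum>i<dim_vec u. u $ i)"
proof -
  have "(\<Sum>i<dim_vec u. order_stat u i) = sum_list (sort (list_of_vec u))"
    by (simp add: order_stat_def sum_list_sum_nth atLeast0LessThan)
  also have "\<dots> = sum_list (list_of_vec u)"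
    by (metis mset_sort sum_mset_sum_list)
  also have "\<dots> = (\<Sum>i<dim_vec u. u $ i)"
    by (simp add: sum_list_sum_nth atLeast0LessThan list_of_vec_index)
  finally show ?thesis .
qed

lemma order_stat_smult:
  assumes "0 < a" "i < dim_vec u"
  shows "order_stat (a \<cdot>\<^sub>v u) i = a * order_stat u i"
proof -
  have l: "list_of_vec (a \<cdot>\<^sub>v u) = map ((*) a) (list_of_vec u)"
    by (rule nth_equalityI) (auto simp: list_of_vec_index)
  have "sorted (map ((*) a) (sort (list_of_vec u)))"
    using assms(1) by (auto simp: sorted_map intro: sorted_wrt_mono_rel[OF _ sorted_sort])
  \<comment> \<open>A sorted permutation of a list is its sort; positivity of \<open>a\<close> is
    what keeps the scaled list sorted.\<close>
  then have "sort (map ((*) a) (list_of_vec u)) = map ((*) a) (sort (list_of_vec u))"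
    by (intro properties_for_sort) simp_all
  then show ?thesis
    using assms(2) by (simp add: order_stat_def l)
qed

lemma order_stat_const_imp:
  assumes "\<And>i. i < dim_vec u \<Longrightarrow> order_stat u i = c"
  shows "u = c \<cdot>\<^sub>v ones_vec (dim_vec u)"
proof (rule eq_vecI)
  fix j assume "j < dim_vec (c \<cdot>\<^sub>v ones_vec (dim_vec u))"
  then have j: "j < dim_vec u" by (simp add: ones_vec_def)
  then have "list_of_vec u ! j \<in> set (sort (list_of_vec u))"
    unfolding set_sort by (intro nth_mem) simp
  then obtain i where "i < dim_vec u" "u $ j = order_stat u i"
    unfolding in_set_conv_nth using j by (auto simp: order_stat_def list_of_vec_index)
  then show "u $ j = (c \<cdot>\<^sub>v ones_vec (dim_vec u)) $ j"
    using assms j by (simp add: ones_vec_def)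
qed (simp add: ones_vec_def)

lemma smult_ones_vec_incr: "a \<cdot>\<^sub>v ones_vec N \<in> incr_vecs N"
  by (auto simp: incr_vecs_def ones_vec_def)

lemma vec_order_stat_incr: "u \<in> carrier_vec N \<Longrightarrow> vec N (order_stat u) \<in> incr_vecs N"
  by (auto simp: incr_vecs_def intro: order_stat_mono)

text \<open>Majorization sees only the total and the order statistics, and rearranging a vector
  changes neither.\<close>

lemma majorized_vec_order_stat:
  assumes "u \<in> carrier_vec N"
  shows "majorized N u (vec N (order_stat u))" "majorized N (vec N (order_stat u)) u"
proof -
  have "order_stat (vec N (order_stat u)) i = order_stat u i" if "i < N" for i
    using order_stat_incr_vecs[OF vec_order_stat_incr[OF assms] that] that by simp
  moreover have "(\<Sum>i<N. order_stat u i) = (\<Sum>i<N. u $ i)"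
    using assms sum_order_stat[of u] by simp
  ultimately show "majorized N u (vec N (order_stat u))" "majorized N (vec N (order_stat u)) u"
    by (simp_all add: majorized_def)
qed

section \<open>Summation by parts and tail sums of weights\<close>

lemma sum_mult_by_parts:
  fixes a b :: "nat \<Rightarrow> real"
  shows "(\<Sum>i<N. a i * b i) =
    a 0 * (\<Sum>i<N. b i) + (\<Sum>k=1..<N. (a k - a (k - 1)) * (\<Sum>i=k..<N. b i))"
proof (induction N)
  case (Suc N)
  show ?case
  proof (cases "N = 0")
    case False
    have tele: "(\<Sum>k=1..<Suc N. a k - a (k - 1)) = a N - a 0"
      by (induction N) auto
    have "(\<Sum>k=1..<Suc N. (a k - a (k - 1)) * (\<Sum>i=k..<Suc N. b i)) =
      (\<Sum>k=1..<Suc N. (a k - a (k - 1)) * (\<Sum>i=k..<N. b i) + (a k - a (k - 1)) * b N)"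
      by (intro sum.cong) (auto simp: algebra_simps)
    \<comment> \<open>The summand \<open>k = N\<close> has an empty inner sum and drops out; the
      coefficients of \<open>b N\<close> telescope.\<close>
    also have "\<dots> = (\<Sum>k=1..<N. (a k - a (k - 1)) * (\<Sum>i=k..<N. b i)) + (a N - a 0) * b N"
      using False unfolding sum.distrib sum_distrib_right[symmetric] tele by simp
    finally show ?thesis
      using Suc.IH by (simp add: algebra_simps)
  qed simp
qed simp

text \<open>If \<open>w $ k\<close> is nonnegative, the tail has nonnegative entries and ends in a
  positive one. Otherwise all entries before \<open>k\<close> are negative too, and since the total
  is 0, the tail must compensate for them.\<close>

lemma weights_tail_sum_pos:
  assumes w: "w \<in> weights N" and k: "0 < k" "k < N"
  shows "0 < (\<Sum>i=k..<N. w $ i)"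
proof (cases "0 \<le> w $ k")
  case True
  have incr: "w \<in> incr_vecs N" using w by (simp add: weights_def)
  show ?thesis
  proof (rule sum_pos2[of _ "N - 1"])
    show "0 \<le> w $ i" if "i \<in> {k..<N}" for i
      using True incr_vecs_mono[OF incr, of k i] that by auto
  qed (use w k in \<open>auto simp: weights_def\<close>)
next
  case False
  have incr: "w \<in> incr_vecs N" using w by (simp add: weights_def)
  have "(\<Sum>i<k. w $ i) < 0"
  proof (rule sum_strict_mono[of "{..<k}" _ "\<lambda>_. 0", simplified])
    show "w $ i < 0" if "i < k" for i
      using False incr_vecs_mono[OF incr, of i k] that k by auto
  qed (use k in auto)
  moreover have "(\<Sum>i<k. w $ i) + (\<Sum>i=k..<N. w $ i) = (\<Sum>i<N. w $ i)"
    using k by (metis atLeast0LessThan le0 less_imp_le sum.atLeastLessThan_concat)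
  ultimately show ?thesis using w by (simp add: weights_def)
qed

section \<open>Order-based measures satisfy the axioms\<close>

lemma order_based_normalization:
  assumes w: "w \<in> weights N" and \<nu>: "order_based_measure N w \<nu>"
  shows "normalization N \<nu>"
proof -
  have "0 \<le> \<nu> u \<and> (\<nu> u = 0 \<longleftrightarrow> (\<exists>a. u = a \<cdot>\<^sub>v ones_vec N))" if u: "u \<in> carrier_vec N" for u
  proof -
    have d: "dim_vec u = N" using u by auto
    let ?t = "\<lambda>k. (order_stat u k - order_stat u (k - 1)) * (\<Sum>i=k..<N. w $ i)"
    \<comment> \<open>The leading term of the summation by parts contains the total of
      \<open>w\<close>, which is 0.\<close>
    have eq: "\<nu> u = (\<Sum>k=1..<N. ?t k)"
      using \<nu> u w sum_mult_by_parts[of "order_stat u" "($) w" N]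
      by (simp add: order_based_measure_def weights_def mult.commute)
    have nn: "0 \<le> ?t k" if "k \<in> {1..<N}" for k
      using that d weights_tail_sum_pos[OF w, of k] order_stat_mono[of "k - 1" k u] by auto
    have "\<exists>a. u = a \<cdot>\<^sub>v ones_vec N" if "\<nu> u = 0"
    proof -
      have z: "?t k = 0" if "k \<in> {1..<N}" for k
        using \<open>\<nu> u = 0\<close> nn that unfolding eq by (subst (asm) sum_nonneg_eq_0_iff) auto
      \<comment> \<open>Each vanishing term is a gap times a positive tail sum, so every gap is
        0.\<close>
      have "order_stat u k = order_stat u 0" if "k < N" for k
        using that
      proof (induction k)
        case (Suc k)
        then show ?case
          using z[of "Suc k"] weights_tail_sum_pos[OF w, of "Suc k"] by auto
      qed simp
      then show ?thesis using order_stat_const_imp[of u] d by metis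
    qed
    moreover have "\<nu> u = 0" if "u = a \<cdot>\<^sub>v ones_vec N" for a
    proof -
      have "order_stat u i = a" if "i < N" for i
        using \<open>u = a \<cdot>\<^sub>v ones_vec N\<close> that order_stat_incr_vecs[OF smult_ones_vec_incr]
        by (simp add: ones_vec_def)
      then show ?thesis unfolding eq by (intro sum.neutral) auto
    qed
    moreover have "0 \<le> \<nu> u" unfolding eq using nn by (rule sum_nonneg)
    ultimately show ?thesis by blast
  qed
  then show ?thesis by (simp add: normalization_def)
qed

lemma order_based_schur_convexity:
  assumes w: "w \<in> incr_vecs N" and \<nu>: "order_based_measure N w \<nu>"
  shows "schur_convexity N \<nu>"
proof -
  have "\<nu> u \<le> \<nu> v"
    if u: "u \<in> carrier_vec N" and v: "v \<in> carrier_vec N" and m: "majorized N u v" for u v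
  proof -
    let ?d = "\<lambda>i. order_stat v i - order_stat u i"
    have "(\<Sum>i<N. ?d i) = 0"
      using u v m sum_order_stat[of u] sum_order_stat[of v]
      by (simp add: sum_subtractf majorized_def)
    \<comment> \<open>Now the weights are differenced and the order statistics summed, so that the
      tail sums of \<open>?d\<close> are exactly the quantities that majorization controls.\<close>
    then have "\<nu> v - \<nu> u = (\<Sum>k=1..<N. (w $ k - w $ (k - 1)) * (\<Sum>i=k..<N. ?d i))"
      using \<nu> u v sum_mult_by_parts[of "($) w" ?d N]
      by (simp add: order_based_measure_def right_diff_distrib sum_subtractf)
    also have "\<dots> \<ge> 0"
    proof (rule sum_nonneg)
      fix k assume k: "k \<in> {1..<N}"
      have "0 \<le> w $ k - w $ (k - 1)"
        using k incr_vecs_mono[OF w, of "k - 1" k] by simp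
      moreover have "0 \<le> (\<Sum>i=k..<N. ?d i)"
        using m k unfolding majorized_def sum_subtractf by simp
      ultimately show "0 \<le> (w $ k - w $ (k - 1)) * (\<Sum>i=k..<N. ?d i)"
        by (rule mult_nonneg_nonneg)
    qed
    finally show ?thesis by simp
  qed
  then show ?thesis by (simp add: schur_convexity_def)
qed

lemma order_based_positive_homogeneity:
  assumes "order_based_measure N w \<nu>"
  shows "positive_homogeneity N \<nu>"
  using assms
  by (simp add: positive_homogeneity_def order_based_measure_def order_stat_smult
      sum_distrib_left mult.left_commute)

text \<open>The bound on the step size stops entry \<open>j\<close> from overtaking its successor.
  Hence the raised vector is still its own rearrangement, and an order-based measure is linear along
  the step.\<close>

lemma incr_vecs_raise:
  assumes "u \<in> incr_vecs N" "j < N" "0 \<le> e" "Suc j < N \<longrightarrow> e \<le> u $ Suc j - u $ j"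
  shows "u + e \<cdot>\<^sub>v unit_vec N j \<in> incr_vecs N"
proof -
  have "(u + e \<cdot>\<^sub>v unit_vec N j) $ i \<le> (u + e \<cdot>\<^sub>v unit_vec N j) $ Suc i" if "Suc i < N" for i
    using assms that by (auto simp: incr_vecs_def intro: add_increasing2)
  then show ?thesis using assms by (auto simp: incr_vecs_def)
qed

lemma order_based_incr_vecs:
  assumes "order_based_measure N w \<nu>" "u \<in> incr_vecs N"
  shows "\<nu> u = (\<Sum>i<N. w $ i * u $ i)"
  using assms order_stat_incr_vecs[OF assms(2)]
  by (simp add: order_based_measure_def incr_vecs_def)

lemma order_based_proportional_adjustment:
  assumes w: "w \<in> carrier_vec N" and \<nu>: "order_based_measure N w \<nu>"
  shows "proportional_adjustment N \<nu>"
  unfolding proportional_adjustment_def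
proof (intro bexI[OF _ w] ballI allI impI)
  fix u j and e :: real
  assume h: "u \<in> incr_vecs N" "j < N" "0 \<le> e" "Suc j < N \<longrightarrow> e \<le> u $ Suc j - u $ j"
  have "\<nu> (u + e \<cdot>\<^sub>v unit_vec N j) = (\<Sum>i<N. w $ i * u $ i + (if i = j then e * w $ j else 0))"
    unfolding order_based_incr_vecs[OF \<nu> incr_vecs_raise[OF h]]
    using h by (intro sum.cong) (auto simp: incr_vecs_def algebra_simps)
  also have "\<dots> = \<nu> u + e * w $ j"
    unfolding order_based_incr_vecs[OF \<nu> h(1)] using h(2) by (simp add: sum.distrib)
  finally show "\<nu> (u + e \<cdot>\<^sub>v unit_vec N j) = \<nu> u + e * w $ j" .
qed

section \<open>From the axioms to the weights\<close>

lemma adjustment_incr_vecs_above: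
  assumes pa: "\<And>u j e. u \<in> incr_vecs N \<Longrightarrow> j < N \<Longrightarrow> 0 \<le> e \<Longrightarrow>
      (Suc j < N \<longrightarrow> e \<le> u $ Suc j - u $ j) \<Longrightarrow>
      \<nu> (u + e \<cdot>\<^sub>v unit_vec N j) = \<nu> u + e * w $ j"
    and u: "u \<in> incr_vecs N" and c: "0 < N \<longrightarrow> c \<le> u $ 0"
  shows "\<nu> u = \<nu> (c \<cdot>\<^sub>v ones_vec N) + (\<Sum>i<N. w $ i * (u $ i - c))"
proof -
  \<comment> \<open>The stages of the climb: \<open>?v N\<close> is constant, \<open>?v 0\<close> is
    \<open>u\<close>, and \<open>k\<close> runs downwards.\<close>
  let ?v = "\<lambda>k. vec N (\<lambda>i. if i < k then c else u $ i)"
  have ge: "c \<le> u $ i" if "i < N" for i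
    using c incr_vecs_mono[OF u, of 0 i] that by auto
  have "\<nu> (?v k) = \<nu> (c \<cdot>\<^sub>v ones_vec N) + (\<Sum>i=k..<N. w $ i * (u $ i - c))" if "k \<le> N" for k
    using that
  proof (induction k rule: inc_induct)
    case base
    have "?v N = c \<cdot>\<^sub>v ones_vec N" by (rule eq_vecI) (auto simp: ones_vec_def)
    then show ?case by simp
  next
    case (step k)
    have incr: "?v (Suc k) \<in> incr_vecs N"
      using u ge by (auto simp: incr_vecs_def)
    \<comment> \<open>The raise is admissible because the next entry, if there is one, already has
      its final value \<open>u $ Suc k\<close>, which is at least \<open>u $ k\<close>.\<close>
    have "?v k = ?v (Suc k) + (u $ k - c) \<cdot>\<^sub>v unit_vec N k"
      using step.hyps by (intro eq_vecI) (auto simp: less_Suc_eq)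
    also have "\<nu> \<dots> = \<nu> (?v (Suc k)) + (u $ k - c) * w $ k"
      using step.hyps ge[of k] u by (intro pa[OF incr]) (auto simp: incr_vecs_def)
    finally show ?case
      using step by (simp add: sum.atLeast_Suc_lessThan)
  qed
  from this[of 0] have "\<nu> (?v 0) = \<nu> (c \<cdot>\<^sub>v ones_vec N) + (\<Sum>i<N. w $ i * (u $ i - c))"
    by (simp add: atLeast0LessThan)
  moreover have "?v 0 = u" using u by (auto simp: incr_vecs_def)
  ultimately show ?thesis by simp
qed

lemma proportional_adjustment_incr_vecs:
  assumes norm: "normalization N \<nu>" and pa: "proportional_adjustment N \<nu>"
  obtains w where "w \<in> carrier_vec N" "(\<Sum>i<N. w $ i) = 0"
    "\<And>u. u \<in> incr_vecs N \<Longrightarrow> \<nu> u = (\<Sum>i<N. w $ i * u $ i)"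
proof -
  obtain w where w: "w \<in> carrier_vec N"
    and adj: "\<And>u j e. u \<in> incr_vecs N \<Longrightarrow> j < N \<Longrightarrow> 0 \<le> e \<Longrightarrow>
      (Suc j < N \<longrightarrow> e \<le> u $ Suc j - u $ j) \<Longrightarrow>
      \<nu> (u + e \<cdot>\<^sub>v unit_vec N j) = \<nu> u + e * w $ j"
    using pa by (auto simp: proportional_adjustment_def)
  have const: "\<nu> (c \<cdot>\<^sub>v ones_vec N) = 0" for c
    using norm smult_ones_vec_incr[of c N] by (auto simp: normalization_def incr_vecs_def)
  \<comment> \<open>Climbing from the zero vector to the all-ones vector adds the total of
    \<open>w\<close>, while \<open>\<nu>\<close> vanishes at both ends.\<close>
  have sum0: "(\<Sum>i<N. w $ i) = 0"
    using adjustment_incr_vecs_above[of N \<nu> w "1 \<cdot>\<^sub>v ones_vec N" 0, OF adj smult_ones_vec_incr]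
    unfolding const by (simp add: ones_vec_def)
  \<comment> \<open>The climb starts at the smallest entry \<open>u $ 0\<close>; its contribution
    cancels because the weights sum to 0.\<close>
  have "\<nu> u = (\<Sum>i<N. w $ i * u $ i)" if "u \<in> incr_vecs N" for u
    using adjustment_incr_vecs_above[of N \<nu> w u "u $ 0", OF adj that] const sum0
    by (simp add: right_diff_distrib sum_subtractf sum_distrib_right[symmetric])
  with that w sum0 show ?thesis by blast
qed

lemma schur_convexity_order_stat:
  assumes "schur_convexity N \<nu>" "u \<in> carrier_vec N"
  shows "\<nu> u = \<nu> (vec N (order_stat u))"
  using assms majorized_vec_order_stat[OF assms(2)]
  by (intro antisym) (auto simp: schur_convexity_def)

lemma schur_convexity_weights_mono:
  assumes sc: "schur_convexity N \<nu>"
    and w: "w \<in> carrier_vec N" "\<And>u. u \<in> incr_vecs N \<Longrightarrow> \<nu> u = (\<Sum>i<N. w $ i * u $ i)"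
  shows "w \<in> incr_vecs N"
proof -
  have "w $ i \<le> w $ Suc i" if i: "Suc i < N" for i
  proof -
    \<comment> \<open>The two ways of raising \<open>(0, 1, \<dots>, N - 1)\<close> by 1 at \<open>i\<close> or \<open>i + 1\<close> both preserve the order.\<close>
    let ?y = "\<lambda>j. vec N (\<lambda>l. real l + (if l = j then 1 else 0))"
    have incr: "?y j \<in> incr_vecs N" for j
      by (auto simp: incr_vecs_def)
    have os: "order_stat (?y j) l = real l + (if l = j then 1 else 0)" if "l < N" for l j
      using order_stat_incr_vecs[OF incr that] that by simp
    \<comment> \<open>Moving the unit from \<open>i\<close> to \<open>Suc i\<close> changes only the
      tail sum from \<open>k = Suc i\<close> on, which grows by 1.\<close>
    have "majorized N (?y i) (?y (Suc i))"
      unfolding majorized_def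
    proof (intro conjI ballI)
      fix k assume "k \<in> {1..<N}"
      show "(\<Sum>l=k..<N. order_stat (?y i) l) \<le> (\<Sum>l=k..<N. order_stat (?y (Suc i)) l)"
        using i by (simp add: os sum.distrib)
    qed (use i in \<open>simp add: sum.distrib\<close>)
    then have "\<nu> (?y i) \<le> \<nu> (?y (Suc i))"
      using sc by (simp add: schur_convexity_def)
    moreover have "\<nu> (?y j) = (\<Sum>l<N. w $ l * real l) + w $ j" if "j < N" for j
      unfolding w(2)[OF incr] using that
      by (simp add: distrib_left sum.distrib if_distrib[of "(*) _"] cong: if_cong)
    ultimately show ?thesis using i by simp
  qed
  with w(1) show ?thesis by (simp add: incr_vecs_def)
qed

lemma normalization_pos:
  assumes "normalization N \<nu>" "u \<in> carrier_vec N" "i < N" "j < N" "u $ i \<noteq> u $ j"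
  shows "0 < \<nu> u"
proof -
  have "u \<noteq> a \<cdot>\<^sub>v ones_vec N" for a
    using assms(3-5) by (auto simp: ones_vec_def)
  with assms(1,2) show ?thesis
    unfolding normalization_def by (metis order_le_less)
qed

lemma axioms_imp_order_based:
  assumes N: "N \<ge> 2" and norm: "normalization N \<nu>" and sc: "schur_convexity N \<nu>"
    and pa: "proportional_adjustment N \<nu>"
  shows "\<exists>w\<in>weights N. order_based_measure N w \<nu>"
proof -
  obtain w where w: "w \<in> carrier_vec N" "(\<Sum>i<N. w $ i) = 0"
    and \<nu>: "\<And>u. u \<in> incr_vecs N \<Longrightarrow> \<nu> u = (\<Sum>i<N. w $ i * u $ i)"
    using proportional_adjustment_incr_vecs[OF norm pa] by blast
  \<comment> \<open>Increasing vectors on which the linear formula isolates the last and the first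
    weight. They are not constant since \<open>N \<ge> 2\<close>, so normalization makes their
    values positive.\<close>
  let ?last = "vec N (\<lambda>i. if i = N - 1 then 1 else 0 :: real)"
  let ?first = "vec N (\<lambda>i. if i = 0 then - 1 else 0 :: real)"
  have "?last \<in> incr_vecs N" "?first \<in> incr_vecs N"
    by (auto simp: incr_vecs_def)
  then have "\<nu> ?last = w $ (N - 1)" "\<nu> ?first = - w $ 0"
    using N by (simp_all add: \<nu> if_distrib cong: if_cong)
  moreover have "0 < \<nu> ?last" "0 < \<nu> ?first"
    using N by (auto intro!: normalization_pos[OF norm, of _ 0 "N - 1"])
  ultimately have "w \<in> weights N"
    using schur_convexity_weights_mono[OF sc w(1) \<nu>] w(2) by (simp add: weights_def)
  moreover have "order_based_measure N w \<nu>"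
    unfolding order_based_measure_def
  proof
    fix u :: "real vec" assume u: "u \<in> carrier_vec N"
    show "\<nu> u = (\<Sum>i<N. w $ i * order_stat u i)"
      unfolding schur_convexity_order_stat[OF sc u] \<nu>[OF vec_order_stat_incr[OF u]] by simp
  qed
  ultimately show ?thesis by blast
qed

theorem theorem2:
  fixes N :: nat and \<nu> :: "real vec \<Rightarrow> real"
  assumes "N \<ge> 2"
  shows "(\<exists>w\<in>weights N. order_based_measure N w \<nu>) \<longleftrightarrow>
    normalization N \<nu> \<and> schur_convexity N \<nu> \<and> positive_homogeneity N \<nu> \<and>
    proportional_adjustment N \<nu>"
proof
  assume "\<exists>w\<in>weights N. order_based_measure N w \<nu>"
  then obtain w where w: "w \<in> weights N" "order_based_measure N w \<nu>" by blast
  then have "w \<in> incr_vecs N" "w \<in> carrier_vec N"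
    by (auto simp: weights_def incr_vecs_def)
  with w show "normalization N \<nu> \<and> schur_convexity N \<nu> \<and> positive_homogeneity N \<nu> \<and>
      proportional_adjustment N \<nu>"
    using order_based_normalization order_based_schur_convexity
      order_based_positive_homogeneity order_based_proportional_adjustment by blast
qed (use axioms_imp_order_based[OF assms] in blast)

end
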